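(* Among the imprimitive complex reflection groups $G(m,p,d)$ ($p\mid m$, $d\ge2$, $(m,p,d)\neq(2,2,2)$), regarded as subgroups of $U(\mathbb{C}^d)$, those which are maximal reflection groups are $$G(2a,2,2),\qquad d=2,\quad a=2,3,4,\ldots,$$ $$G(ka,k,d),\qquad d\ge3,\quad k\mid d,\quad a=1,2,3,\ldots,$$ and the remaining ones are proper normal subgroups of the maximal reflection groups that contain them, namely (the larger group being the maximal reflection group for the smaller one) $$G(m,p,2)\lhd G\Big(\tfrac{2m}{\gcd(m,p,2)},2,2\Big),\qquad d=2,$$ $$G(m,p,d)\lhd G(m,\gcd(p,d),d),\qquad d\ge3.$$
   Context: A reflection on $\mathbb{C}^d$ is an invertible linear map $g$ with $\mathrm{rank}(I-g)=1$; a complex reflection group is a finite group generated by reflections. For positive integers $m,p,d$ with $p\mid m$, $G(m,p,d)\subset U(\mathbb{C}^d)$ is the group of $d\times d$ monomial matrices whose nonzero entries are $m$-th roots of unity with product an $(m/p)$-th root of unity. The maximal reflection group for a complex reflection group $G\subset U(\mathbb{C}^d)$ is the group generated by all reflections of the form $\lambda g$, $\lambda\in\mathbb{C}^*$, $g\in G$; $G$ is a maximal reflection group if it equals its maximal reflection group. For $d=2$ inclusions are up to conjugacy in $GL(\mathbb{C}^2)$. *)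

theory Defs
  imports "HOL-Analysis.Analysis" "HOL-Algebra.Generated_Groups"
begin

text \<open>\<open>\<complex>\<^sup>d\<close> is \<open>complex ^ 'd\<close> with \<open>d = CARD('d)\<close>; linear maps are identified with
  their matrices in the standard basis.\<close>

definition GL :: "(complex ^ 'd ^ 'd) monoid" where
  "GL = \<lparr>carrier = {A. invertible A}, mult = (**), one = mat 1\<rparr>"

definition unitary_matrices :: "(complex ^ 'd ^ 'd) set" where
  "unitary_matrices = {A. A ** map_matrix cnj (transpose A) = mat 1}"

definition reflection :: "complex ^ 'd ^ 'd \<Rightarrow> bool" where
  "reflection g \<longleftrightarrow> invertible g \<and> rank (mat 1 - g) = 1"

definition complex_reflection_group :: "(complex ^ 'd ^ 'd) set \<Rightarrow> bool" where
  "complex_reflection_group G \<longleftrightarrow>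
     finite G \<and> subgroup G GL \<and> (\<exists>S. (\<forall>g\<in>S. reflection g) \<and> G = generate GL S)"

definition monomial_matrix :: "complex ^ 'd ^ 'd \<Rightarrow> bool" where
  "monomial_matrix A \<longleftrightarrow>
     (\<forall>i. \<exists>!j. A $ i $ j \<noteq> 0) \<and> (\<forall>j. \<exists>!i. A $ i $ j \<noteq> 0)"

text \<open>The group \<open>G(m,p,d)\<close>; \<open>d\<close> is given by the type. Meaningful for \<open>m > 0\<close> and \<open>p dvd m\<close>.\<close>

definition Gmp :: "nat \<Rightarrow> nat \<Rightarrow> (complex ^ 'd ^ 'd) set" where
  "Gmp m p = {A. monomial_matrix A
     \<and> (\<forall>i j. A $ i $ j \<noteq> 0 \<longrightarrow> (A $ i $ j) ^ m = 1)
     \<and> (\<Prod>(i, j) \<in> {(i, j). A $ i $ j \<noteq> 0}. A $ i $ j) ^ (m div p) = 1}"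

text \<open>\<open>mat c ** g\<close> is the scalar multiple of \<open>g\<close> by \<open>c\<close>.\<close>

definition max_reflection_group_of :: "(complex ^ 'd ^ 'd) set \<Rightarrow> (complex ^ 'd ^ 'd) set" where
  "max_reflection_group_of G =
     generate GL {r. reflection r \<and> (\<exists>c g. c \<noteq> 0 \<and> g \<in> G \<and> r = mat c ** g)}"

definition maximal_reflection_group :: "(complex ^ 'd ^ 'd) set \<Rightarrow> bool" where
  "maximal_reflection_group G \<longleftrightarrow>
     complex_reflection_group G \<and> G \<subseteq> unitary_matrices \<and> max_reflection_group_of G = G"

definition proper_normal_subgroup ::
    "(complex ^ 'd ^ 'd) set \<Rightarrow> (complex ^ 'd ^ 'd) set \<Rightarrow> bool" where
  "proper_normal_subgroup N H \<longleftrightarrow> subgroup H GL \<and> N \<lhd> GL\<lparr>carrier := H\<rparr> \<and> N \<noteq> H"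

end

theory Submission
  imports Defs
begin

text \<open>
  A monomial matrix is a reflection only if it is diagonal with a single entry \<open>t \<noteq> 1\<close>, or is
  supported on a transposition with the two off-diagonal entries \<open>s\<close>, \<open>s\<^bsup>-1\<^esup>\<close>. Such reflections
  generate \<open>G(m,p,d)\<close> if \<open>s\<close> runs over the \<open>m\<close>-th and \<open>t\<close> over the \<open>(m/p)\<close>-th roots of unity. Among
  scalar multiples of elements of \<open>G(m,p,d)\<close>, one finds precisely the \<open>t\<close> with \<open>t\<^bsup>m/gcd(p,d)\<^esup> = 1\<close>.
  If \<open>d \<ge> 3\<close>, then a reflection supported on a transposition fixes some basis vector, which forces the
  scalar to be an \<open>m\<close>-th root of unity, so that no new \<open>s\<close> occurs; if \<open>d = 2\<close>, then \<open>s\<^sup>2\<close> is a quotient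
  of two entries, and \<open>s\<close> runs over the roots of unity of order dividing \<open>2m/gcd(p,2)\<close>.
  Normality holds for every group: conjugation by \<open>\<lambda>g\<close> is conjugation by \<open>g\<close>.
\<close>

section \<open>Roots of unity\<close>

text \<open>It suffices to test the primitive root \<open>exp (2 * pi * \<i> / a)\<close>, whose
  \<open>b\<close>-th power is 1 only if \<open>a\<close> divides \<open>b\<close>. This is how
  exponents are recovered from sets of roots of unity.\<close>

lemma root_of_unity_dvd:
  fixes a b :: nat
  assumes "a > 0" and "\<And>z::complex. z ^ a = 1 \<Longrightarrow> z ^ b = 1"
  shows "a dvd b"
proof -
  define z :: complex where "z = exp (2 * of_real pi * \<i> * of_nat 1 / of_nat a)"
  have "z ^ a = 1"
    unfolding z_def using assms(1) by (intro complex_root_unity) auto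
  then have "z ^ b = 1"
    by (rule assms(2))
  moreover have "z ^ b = exp (2 * of_real pi * \<i> * of_nat b / of_nat a)"
    unfolding z_def by (simp flip: exp_of_nat_mult add: mult_ac)
  ultimately show ?thesis
    using complex_root_unity_eq_1 [of a b] assms(1) by auto
qed

text \<open>The exponent \<open>m div g\<close> is a multiple of \<open>m div p\<close>. If
  \<open>p = 0\<close>, then also \<open>m = 0\<close>, and the exponent is 0.\<close>

lemma power_div_eq_1:
  fixes z :: "'a::monoid_mult"
  assumes "z ^ (m div p) = 1" and "g dvd p" and "p dvd m"
  shows "z ^ (m div g) = 1"
proof -
  obtain k where k: "p = g * k" using assms(2) by blast
  obtain l where l: "m = p * l" using assms(3) by blast
  show ?thesis
  proof (cases "p = 0")
    case True
    then show ?thesis using l by simp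
  next
    case False
    then have "m div g = (m div p) * k" using k l by simp
    then show ?thesis using assms(1) by (simp add: power_mult)
  qed
qed

section \<open>Matrices of rank one\<close>

text \<open>The rank is the dimension of the row space, and a nonzero space contained in a line has
  dimension 1. The entrywise form can be checked directly on explicit matrices.\<close>

lemma rank_eq_1_iff:
  fixes A :: "'a::field ^ 'n ^ 'm"
  shows "rank A = 1 \<longleftrightarrow> A \<noteq> 0 \<and> (\<exists>v. \<forall>i. \<exists>c. \<forall>j. A $ i $ j = c * v $ j)"
proof
  assume r: "rank A = 1"
  then have d: "vec.dim (rows A) = 1"
    by (simp add: row_rank_def_gen)
  obtain B where B: "rows A \<subseteq> vec.span B" "card B = 1"
    using vec.basis_exists [of "rows A"] d by metis
  then obtain v where "B = {v}"
    by (auto simp: card_1_singleton_iff)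
  then have "\<exists>c. row i A = c *s v" for i
    using B(1) by (auto simp: rows_def vec.span_singleton)
  then have "\<forall>i. \<exists>c. \<forall>j. A $ i $ j = c * v $ j"
    by (auto simp: row_def vec_eq_iff)
  moreover have "A \<noteq> 0"
  proof
    assume "A = 0"
    then have "rows A \<subseteq> {0}"
      by (auto simp: rows_def row_def vec_eq_iff)
    then have "vec.dim (rows A) = 0"
      by simp
    with d show False by simp
  qed
  ultimately show "A \<noteq> 0 \<and> (\<exists>v. \<forall>i. \<exists>c. \<forall>j. A $ i $ j = c * v $ j)"
    by blast
next
  assume *: "A \<noteq> 0 \<and> (\<exists>v. \<forall>i. \<exists>c. \<forall>j. A $ i $ j = c * v $ j)"
  then obtain v where v: "\<And>i. \<exists>c. \<forall>j. A $ i $ j = c * v $ j"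
    by blast
  have "row i A \<in> vec.span {v}" for i
  proof -
    obtain c where "\<forall>j. A $ i $ j = c * v $ j" using v by blast
    then have "row i A = c *s v" by (simp add: row_def vec_eq_iff)
    then show ?thesis by (auto simp: vec.span_singleton)
  qed
  then have "rows A \<subseteq> vec.span {v}"
    by (auto simp: rows_def)
  then have "vec.dim (rows A) \<le> 1"
    using vec.dim_le_card [of "rows A" "{v}"] by simp
  moreover have "vec.dim (rows A) \<noteq> 0"
  proof
    assume "vec.dim (rows A) = 0"
    then have "rows A \<subseteq> {0}"
      by simp
    then have "row i A = 0" for i
      by (auto simp: rows_def)
    then have "A = 0"
      by (simp add: row_def vec_eq_iff)
    with * show False by simp
  qed
  ultimately have "vec.dim (rows A) = 1"
    by linarith
  then show "rank A = 1"
    by (simp add: row_rank_def_gen)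
qed

section \<open>Monomial matrices\<close>

text \<open>Row \<open>i\<close> has its entry in column \<open>\<sigma> i\<close>. With this
  convention a matrix product composes the maps in reverse order.\<close>

definition monomial :: "('d \<Rightarrow> 'd) \<Rightarrow> ('d \<Rightarrow> complex) \<Rightarrow> complex ^ 'd ^ 'd" where
  "monomial \<sigma> u = (\<chi> i j. if j = \<sigma> i then u i else 0)"

lemma monomial_nth [simp]: "monomial \<sigma> u $ i $ j = (if j = \<sigma> i then u i else 0)"
  by (simp add: monomial_def)

lemma monomial_mult:
  "monomial \<sigma> u ** monomial \<tau> v = monomial (\<tau> \<circ> \<sigma>) (\<lambda>i. u i * v (\<sigma> i))"
proof -
  have "(\<Sum>j\<in>UNIV. monomial \<sigma> u $ i $ j * monomial \<tau> v $ j $ k) =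
      (\<Sum>j\<in>UNIV. if j = \<sigma> i then u i * (if k = \<tau> j then v j else 0) else 0)" for i k
    by (intro sum.cong) auto
  then show ?thesis
    by (simp add: vec_eq_iff matrix_matrix_mult_def)
qed

lemma mat_eq_monomial: "mat c = monomial id (\<lambda>i. c)"
  by (auto simp: vec_eq_iff mat_def)

lemma mat_mult_monomial: "mat c ** monomial \<sigma> u = monomial \<sigma> (\<lambda>i. c * u i)"
  by (simp add: mat_eq_monomial monomial_mult)

lemma monomial_left_inverse:
  assumes "bij \<sigma>" and "\<And>i. u i \<noteq> 0"
  shows "monomial (inv_into UNIV \<sigma>) (\<lambda>i. inverse (u (inv_into UNIV \<sigma> i))) ** monomial \<sigma> u = mat 1"
proof -
  have "\<sigma> \<circ> inv_into UNIV \<sigma> = id"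
    using assms(1) by (simp add: bij_is_surj flip: surj_iff)
  then show ?thesis
    using assms(2) by (simp add: monomial_mult mat_eq_monomial)
qed

lemma monomial_right_inverse:
  assumes "bij \<sigma>" and "\<And>i. u i \<noteq> 0"
  shows "monomial \<sigma> u ** monomial (inv_into UNIV \<sigma>) (\<lambda>i. inverse (u (inv_into UNIV \<sigma> i))) = mat 1"
  using assms by (simp add: monomial_mult mat_eq_monomial bij_is_inj)

lemma invertible_monomial:
  assumes "bij \<sigma>" and "\<And>i. u i \<noteq> 0"
  shows "invertible (monomial \<sigma> u)"
  unfolding invertible_def
  using monomial_left_inverse [of \<sigma> u] monomial_right_inverse [of \<sigma> u] assms by blast

section \<open>Reflections among the monomial matrices\<close>

definition transp_refl :: "'d \<Rightarrow> 'd \<Rightarrow> complex \<Rightarrow> complex ^ 'd ^ 'd" where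
  "transp_refl a b c = monomial (Transposition.transpose a b)
     (\<lambda>k. if k = a then c else if k = b then inverse c else 1)"

definition diag_refl :: "'d \<Rightarrow> complex \<Rightarrow> complex ^ 'd ^ 'd" where
  "diag_refl a t = monomial id (\<lambda>k. if k = a then t else 1)"

lemma reflection_transp_refl:
  assumes "a \<noteq> b" and "c \<noteq> 0"
  shows "reflection (transp_refl a b c)"
proof -
  let ?A = "mat 1 - transp_refl a b c"
  \<comment> \<open>The linear form \<open>x_a - c * x_b\<close>, whose kernel is the mirror. Rows
    \<open>a\<close> and \<open>b\<close> of \<open>?A\<close> are 1 and \<open>- inverse c\<close>
    times this form, and all other rows vanish.\<close>
  let ?v = "\<chi> j. if j = a then 1 else if j = b then - c else (0::complex)"
  have "\<forall>j. ?A $ i $ j = (if i = a then 1 else if i = b then - inverse c else 0) * ?v $ j" for i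
    using assms by (auto simp: transp_refl_def mat_def transpose_def)
  then have "\<exists>v. \<forall>i. \<exists>c. \<forall>j. ?A $ i $ j = c * v $ j"
    by blast
  moreover have "?A $ a $ a \<noteq> 0"
    using assms by (auto simp: transp_refl_def mat_def)
  then have "?A \<noteq> 0"
    by (metis zero_index)
  ultimately have "rank ?A = 1"
    unfolding rank_eq_1_iff by blast
  moreover have "invertible (transp_refl a b c)"
    unfolding transp_refl_def using assms by (intro invertible_monomial) auto
  ultimately show ?thesis
    by (simp add: reflection_def)
qed

lemma reflection_diag_refl:
  assumes "t \<noteq> 1" and "t \<noteq> 0"
  shows "reflection (diag_refl a t)"
proof -
  let ?A = "mat 1 - diag_refl a t"
  let ?v = "\<chi> j. if j = a then 1 - t else (0::complex)"
  have "\<forall>j. ?A $ i $ j = (if i = a then 1 else 0) * ?v $ j" for i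
    by (auto simp: diag_refl_def mat_def)
  then have "\<exists>v. \<forall>i. \<exists>c. \<forall>j. ?A $ i $ j = c * v $ j"
    by blast
  moreover have "?A $ a $ a \<noteq> 0"
    using assms by (auto simp: diag_refl_def mat_def)
  then have "?A \<noteq> 0"
    by (metis zero_index)
  ultimately have "rank ?A = 1"
    unfolding rank_eq_1_iff by blast
  moreover have "invertible (diag_refl a t)"
    unfolding diag_refl_def using assms by (intro invertible_monomial) auto
  ultimately show ?thesis
    by (simp add: reflection_def)
qed

text \<open>A matrix of rank one has entries \<open>c i * v $ j\<close>. If \<open>\<sigma>\<close>
  is the identity, two diagonal entries different from 1 would give two independent rows of
  \<open>?A\<close>. If \<open>\<sigma>\<close> moves \<open>a\<close> to \<open>b\<close>, row
  \<open>a\<close> is supported on columns \<open>a\<close> and \<open>b\<close>, so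
  \<open>v\<close> vanishes elsewhere and every other basis vector is fixed.\<close>

lemma reflection_monomial_cases:
  assumes "reflection (monomial \<sigma> w)" and "bij \<sigma>" and nz: "\<And>i. w i \<noteq> 0"
  obtains (diag) a where "\<sigma> = id" "w a \<noteq> 1" "\<And>k. k \<noteq> a \<Longrightarrow> w k = 1"
  | (transp) a b where "a \<noteq> b" "\<sigma> = Transposition.transpose a b" "w a * w b = 1"
      "\<And>k. k \<noteq> a \<Longrightarrow> k \<noteq> b \<Longrightarrow> w k = 1"
proof -
  let ?A = "mat 1 - monomial \<sigma> w"
  have "?A \<noteq> 0" and "\<exists>v. \<forall>i. \<exists>c. \<forall>j. ?A $ i $ j = c * v $ j"
    using assms(1) unfolding reflection_def rank_eq_1_iff by blast+
  then obtain v c where A: "\<And>i j. ?A $ i $ j = c i * v $ j"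
    by metis
  have *: "c i * v $ j = (if i = j then 1 else 0) - (if j = \<sigma> i then w i else 0)" for i j
    using A [of i j] by (simp add: mat_def)
  show thesis
  proof (cases "\<sigma> = id")
    case True
    obtain a j where "?A $ a $ j \<noteq> 0"
      using \<open>?A \<noteq> 0\<close> by (auto simp: vec_eq_iff)
    then have "j = a" "w a \<noteq> 1"
      using True by (auto simp: mat_def split: if_splits)
    then have "c a * v $ a \<noteq> 0"
      using * [of a a] True by simp
    then have "v $ a \<noteq> 0"
      by simp
    have "w k = 1" if "k \<noteq> a" for k
    proof -
      have "c k * v $ a = 0"
        using * [of k a] that True by simp
      then have "c k = 0"
        using \<open>v $ a \<noteq> 0\<close> by simp
      then show ?thesis
        using * [of k k] True by simp
    qed
    then show thesis
      using True \<open>w a \<noteq> 1\<close> diag by blast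
  next
    case False
    then obtain a where a: "\<sigma> a \<noteq> a"
      by (auto simp: fun_eq_iff)
    define b where "b = \<sigma> a"
    have ca: "c a * v $ a = 1" and cb: "c a * v $ b = - w a"
      using * [of a a] * [of a b] a by (auto simp: b_def)
    then have "c a \<noteq> 0"
      by auto
    have fix_other: "\<sigma> k = k \<and> w k = 1" if "k \<noteq> a" "k \<noteq> b" for k
    proof -
      have "c a * v $ k = 0"
        using * [of a k] that by (simp add: b_def)
      then have "v $ k = 0"
        using \<open>c a \<noteq> 0\<close> by simp
      then show ?thesis
        using * [of k k] by (auto split: if_splits)
    qed
    \<comment> \<open>If \<open>\<sigma> b\<close> lay outside \<open>{a, b}\<close>, it would be a
      fixed point and injectivity would give \<open>\<sigma> b = b\<close>. But
      \<open>\<sigma> b = b = \<sigma> a\<close> contradicts \<open>a \<noteq> b\<close>.\<close>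
    have "\<sigma> b = a"
      using fix_other [of "\<sigma> b"] a bij_is_inj [OF assms(2)] unfolding b_def
      by (metis injD)
    have "\<sigma> = Transposition.transpose a b"
    proof
      show "\<sigma> k = Transposition.transpose a b k" for k
        using fix_other [of k] \<open>\<sigma> b = a\<close> b_def by (cases "k = a"; cases "k = b") auto
    qed
    moreover have "c b * v $ b = 1" "c b * v $ a = - w b"
      using * [of b b] * [of b a] \<open>\<sigma> b = a\<close> a by (auto simp: b_def)
    then have "w a = - (c a * v $ b)" "w b = - (c b * v $ a)"
      using cb by simp_all
    \<comment> \<open>This is the vanishing of the 2 by 2 minor of \<open>?A\<close> on rows and
      columns \<open>a\<close>, \<open>b\<close>, whose diagonal entries are both 1.\<close>
    then have "w a * w b = (c a * v $ a) * (c b * v $ b)"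
      by (simp only: minus_mult_minus ac_simps)
    then have "w a * w b = 1"
      using ca \<open>c b * v $ b = 1\<close> by simp
    ultimately show thesis
    proof (intro transp [of a b])
      show "a \<noteq> b"
        using a by (simp add: b_def)
      show "w k = 1" if "k \<noteq> a" "k \<noteq> b" for k
        using fix_other [OF that] by blast
    qed
  qed
qed

section \<open>The groups \<open>G(m,p,d)\<close>\<close>

text \<open>The support of a monomial matrix is the graph of a bijection, so the product over the
  support becomes a product over the rows. Since \<open>m > 0\<close>, the roots of unity are
  nonzero, and the support of \<open>monomial \<sigma> u\<close> is the whole graph.\<close>

lemma Gmp_eq:
  assumes "m > 0"
  shows "(Gmp m p :: (complex ^ 'd ^ 'd) set) =
    {monomial \<sigma> u | \<sigma> u. bij \<sigma> \<and> (\<forall>i. u i ^ m = 1) \<and> (\<Prod>i\<in>UNIV. u i) ^ (m div p) = 1}"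
    (is "_ = ?R")
proof (intro subset_antisym subsetI)
  fix A :: "complex ^ 'd ^ 'd"
  assume A: "A \<in> Gmp m p"
  then have mono: "monomial_matrix A"
    and pow: "\<And>i j. A $ i $ j \<noteq> 0 \<Longrightarrow> (A $ i $ j) ^ m = 1"
    and prod: "(\<Prod>(i, j) \<in> {(i, j). A $ i $ j \<noteq> 0}. A $ i $ j) ^ (m div p) = 1"
    by (auto simp: Gmp_def)
  from mono obtain \<sigma> where \<sigma>: "\<And>i j. A $ i $ j \<noteq> 0 \<longleftrightarrow> j = \<sigma> i"
    unfolding monomial_matrix_def by metis
  have "inj \<sigma>"
  proof (rule injI)
    fix x y assume "\<sigma> x = \<sigma> y"
    then show "x = y"
      using mono \<sigma> unfolding monomial_matrix_def by metis
  qed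
  then have "bij \<sigma>"
    by (simp add: bij_def finite_UNIV_inj_surj)
  have "{(i, j). A $ i $ j \<noteq> 0} = (\<lambda>i. (i, \<sigma> i)) ` UNIV"
    using \<sigma> by auto
  then have "(\<Prod>(i, j) \<in> {(i, j). A $ i $ j \<noteq> 0}. A $ i $ j) = (\<Prod>i\<in>UNIV. A $ i $ \<sigma> i)"
    by (simp add: prod.reindex inj_on_def)
  moreover have "A = monomial \<sigma> (\<lambda>i. A $ i $ \<sigma> i)"
    using \<sigma> by (auto simp: vec_eq_iff)
  ultimately show "A \<in> ?R"
    using \<open>bij \<sigma>\<close> pow prod \<sigma>
    by (intro CollectI exI [of _ \<sigma>] exI [of _ "\<lambda>i. A $ i $ \<sigma> i"]) simp
next
  fix A :: "complex ^ 'd ^ 'd"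
  assume "A \<in> ?R"
  then obtain \<sigma> u where A: "A = monomial \<sigma> u" and \<sigma>: "bij \<sigma>" and u: "\<And>i. u i ^ m = 1"
    and prod: "(\<Prod>i\<in>UNIV. u i) ^ (m div p) = 1"
    by blast
  have nz: "u i \<noteq> 0" for i
    using u [of i] assms by (auto simp: power_0_left)
  have "{(i, j). A $ i $ j \<noteq> 0} = (\<lambda>i. (i, \<sigma> i)) ` UNIV"
    using nz by (auto simp: A)
  then have "(\<Prod>(i, j) \<in> {(i, j). A $ i $ j \<noteq> 0}. A $ i $ j) = (\<Prod>i\<in>UNIV. u i)"
    by (simp add: prod.reindex inj_on_def A)
  moreover have "monomial_matrix A"
  proof -
    have "A $ i $ j \<noteq> 0 \<longleftrightarrow> \<sigma> i = j" for i j
      using nz by (auto simp: A)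
    then show ?thesis
      using \<sigma> by (simp add: monomial_matrix_def bij_iff)
  qed
  moreover have "(A $ i $ j) ^ m = 1" if "A $ i $ j \<noteq> 0" for i j
    using that u by (simp add: A split: if_splits)
  ultimately show "A \<in> Gmp m p"
    using prod unfolding Gmp_def by simp
qed

lemma root_of_unity_nonzero:
  fixes z :: complex
  assumes "z ^ m = 1" and "m > 0"
  shows "z \<noteq> 0"
  using assms by (auto simp: power_0_left)

lemma monomial_in_Gmp:
  assumes "m > 0" "bij \<sigma>" "\<And>i. u i ^ m = 1" "(\<Prod>i\<in>UNIV. u i) ^ (m div p) = 1"
  shows "monomial \<sigma> u \<in> Gmp m p"
  unfolding Gmp_eq [OF assms(1)] using assms by blast

lemma Gmp_cases:
  assumes "A \<in> Gmp m p" "m > 0"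
  obtains \<sigma> u where "A = monomial \<sigma> u" "bij \<sigma>" "\<And>i. u i ^ m = 1"
    "(\<Prod>i\<in>UNIV. u i) ^ (m div p) = 1" "\<And>i. u i \<noteq> 0"
  using assms(1) unfolding Gmp_eq [OF assms(2)] using root_of_unity_nonzero [OF _ assms(2)] by blast

text \<open>The nonzero entries \<open>c\<close>, \<open>inverse c\<close> and 1 have product 1, so
  the condition on the product always holds and these reflections detect \<open>m\<close>
  alone.\<close>

lemma transp_refl_in_Gmp_iff:
  assumes "m > 0" "a \<noteq> b"
  shows "transp_refl a b c \<in> Gmp m p \<longleftrightarrow> c ^ m = 1"
proof
  assume "transp_refl a b c \<in> Gmp m p"
  then have "\<And>i j. transp_refl a b c $ i $ j \<noteq> 0 \<Longrightarrow> (transp_refl a b c $ i $ j) ^ m = 1"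
    and m: "monomial_matrix (transp_refl a b c)"
    by (auto simp: Gmp_def)
  from this(1) [of a b] have "c \<noteq> 0 \<Longrightarrow> c ^ m = 1"
    by (simp add: transp_refl_def)
  moreover have "c \<noteq> 0"
  proof -
    obtain j where "transp_refl a b c $ a $ j \<noteq> 0"
      using m unfolding monomial_matrix_def by blast
    then show ?thesis
      by (auto simp: transp_refl_def split: if_splits)
  qed
  ultimately show "c ^ m = 1" by blast
next
  assume c: "c ^ m = 1"
  then have "c \<noteq> 0"
    using assms root_of_unity_nonzero by blast
  have "(\<Prod>k\<in>UNIV. if k = a then c else if k = b then inverse c else 1) =
      (\<Prod>k\<in>UNIV. (if k = a then c else 1) * (if k = b then inverse c else 1))"
    using assms by (intro prod.cong) auto
  also have "\<dots> = 1"
    using \<open>c \<noteq> 0\<close> by (simp add: prod.distrib)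
  finally show "transp_refl a b c \<in> Gmp m p"
    unfolding transp_refl_def using assms c
    by (intro monomial_in_Gmp) (auto simp: power_inverse)
qed

text \<open>The product of the entries is \<open>t\<close> itself, and \<open>t ^ m = 1\<close>
  follows because \<open>m div p\<close> divides \<open>m\<close>. These reflections detect
  \<open>m div p\<close>.\<close>

lemma diag_refl_in_Gmp_iff:
  assumes "m > 0" "p dvd m"
  shows "diag_refl a t \<in> Gmp m p \<longleftrightarrow> t ^ (m div p) = 1"
proof
  assume "diag_refl a t \<in> Gmp m p"
  then obtain \<sigma> u where eq: "diag_refl a t = monomial \<sigma> u" and u: "(\<Prod>i\<in>UNIV. u i) ^ (m div p) = 1"
    and nz: "\<And>i. u i \<noteq> 0"
    by (rule Gmp_cases [OF _ assms(1)]) blast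
  \<comment> \<open>Compare the entries in position \<open>(i, \<sigma> i)\<close>: the one on the
    right is nonzero, and a nonzero entry of a diagonal matrix forces
    \<open>\<sigma> i = i\<close>.\<close>
  have "u i = (if i = a then t else 1)" for i
  proof -
    have "u i = (if \<sigma> i = i then if i = a then t else 1 else 0)"
      using arg_cong [OF eq, of "\<lambda>A. A $ i $ \<sigma> i"] by (simp add: diag_refl_def)
    then show ?thesis
      using nz [of i] by (simp split: if_splits)
  qed
  then show "t ^ (m div p) = 1"
    using u by simp
next
  assume t: "t ^ (m div p) = 1"
  then have "t ^ m = 1"
    using power_div_eq_1 [of t m p 1] assms by simp
  then show "diag_refl a t \<in> Gmp m p"
    unfolding diag_refl_def using assms t by (intro monomial_in_Gmp) auto
qed

section \<open>\<open>G(m,p,d)\<close> as a finite unitary subgroup of the general linear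
  group\<close>

lemma group_GL: "group GL"
proof (rule groupI)
  show "\<exists>y\<in>carrier GL. y \<otimes>\<^bsub>GL\<^esub> x = \<one>\<^bsub>GL\<^esub>" if "x \<in> carrier GL" for x
    using that by (auto simp: GL_def invertible_def)
next
  show "\<one>\<^bsub>GL\<^esub> \<in> carrier GL"
    unfolding GL_def invertible_def by auto
qed (auto simp: GL_def invertible_mult matrix_mul_assoc)

interpretation GL: group GL
  by (rule group_GL)

lemma GL_mult [simp]: "x \<otimes>\<^bsub>GL\<^esub> y = x ** y"
  by (simp add: GL_def)

lemma GL_one [simp]: "\<one>\<^bsub>GL\<^esub> = mat 1"
  by (simp add: GL_def)

lemma GL_carrier [simp]: "x \<in> carrier GL \<longleftrightarrow> invertible x"
  by (simp add: GL_def)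

lemma GL_inv_monomial:
  assumes "bij \<sigma>" and "\<And>i. u i \<noteq> 0"
  shows "inv\<^bsub>GL\<^esub> monomial \<sigma> u = monomial (inv_into UNIV \<sigma>) (\<lambda>i. inverse (u (inv_into UNIV \<sigma> i)))"
  using assms monomial_left_inverse [OF assms] invertible_monomial [OF assms]
  by (intro GL.inv_equality) (auto intro!: invertible_monomial simp: bij_imp_bij_inv)

lemma subgroup_Gmp:
  assumes "m > 0"
  shows "subgroup (Gmp m p) GL"
proof (rule GL.subgroupI)
  show "Gmp m p \<subseteq> carrier GL"
    using assms by (auto elim!: Gmp_cases intro!: invertible_monomial)
  have "monomial id (\<lambda>i. 1) \<in> Gmp m p"
    using assms by (intro monomial_in_Gmp) auto
  then show "Gmp m p \<noteq> {}"
    by blast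
next
  fix A :: "complex ^ 'd ^ 'd"
  assume "A \<in> Gmp m p"
  then obtain \<sigma> u where A: "A = monomial \<sigma> u" "bij \<sigma>" "\<And>i. u i ^ m = 1"
    "(\<Prod>i\<in>UNIV. u i) ^ (m div p) = 1" "\<And>i. u i \<noteq> 0"
    using Gmp_cases assms by blast
  have "(\<Prod>i\<in>UNIV. inverse (u (inv_into UNIV \<sigma> i))) = inverse (\<Prod>i\<in>UNIV. u i)"
    using A(2) prod.reindex_bij_betw [OF bij_imp_bij_inv [OF A(2)], of "\<lambda>i. inverse (u i)"]
    by (simp add: o_def flip: prod_inversef)
  then show "inv\<^bsub>GL\<^esub> A \<in> Gmp m p"
    using A assms by (auto simp: GL_inv_monomial bij_imp_bij_inv power_inverse intro!: monomial_in_Gmp)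
next
  fix A B :: "complex ^ 'd ^ 'd"
  assume "A \<in> Gmp m p" "B \<in> Gmp m p"
  then obtain \<sigma> u \<tau> v where A: "A = monomial \<sigma> u" "bij \<sigma>" "\<And>i. u i ^ m = 1"
    "(\<Prod>i\<in>UNIV. u i) ^ (m div p) = 1"
    and B: "B = monomial \<tau> v" "bij \<tau>" "\<And>i. v i ^ m = 1" "(\<Prod>i\<in>UNIV. v i) ^ (m div p) = 1"
    using Gmp_cases assms by meson
  have "(\<Prod>i\<in>UNIV. v (\<sigma> i)) = (\<Prod>i\<in>UNIV. v i)"
    using A(2) by (rule prod.reindex_bij_betw)
  then show "A \<otimes>\<^bsub>GL\<^esub> B \<in> Gmp m p"
    using A B assms by (auto simp: monomial_mult bij_comp power_mult_distrib prod.distrib intro!: monomial_in_Gmp)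
qed

lemma finite_Gmp:
  assumes "m > 0"
  shows "finite (Gmp m p :: (complex ^ 'd ^ 'd) set)"
proof (rule finite_subset)
  let ?U = "{z::complex. z ^ m = 1}"
  show "Gmp m p \<subseteq> (\<lambda>(\<sigma>, u). monomial \<sigma> u) ` (UNIV \<times> (UNIV \<rightarrow>\<^sub>E ?U) :: (('d \<Rightarrow> 'd) \<times> _) set)"
    using assms by (auto elim!: Gmp_cases simp: image_iff PiE_def)
  show "finite ((\<lambda>(\<sigma>, u). monomial \<sigma> u) ` (UNIV \<times> (UNIV \<rightarrow>\<^sub>E ?U) :: (('d \<Rightarrow> 'd) \<times> _) set))"
    using assms by (intro finite_imageI finite_cartesian_product finite_PiE finite_roots_unity) auto
qed

text \<open>Roots of unity have norm 1, so conjugating them inverts them, and the conjugate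
  transpose is the monomial inverse.\<close>

lemma Gmp_subset_unitary:
  assumes "m > 0"
  shows "Gmp m p \<subseteq> unitary_matrices"
proof
  fix A :: "complex ^ 'd ^ 'd"
  assume "A \<in> Gmp m p"
  then obtain \<sigma> u where A: "A = monomial \<sigma> u" "bij \<sigma>" "\<And>i. u i ^ m = 1" "\<And>i. u i \<noteq> 0"
    using Gmp_cases assms by blast
  have "cnj (u i) = inverse (u i)" for i
  proof -
    have "norm (u i) = 1"
      using assms power_eq_1_iff [OF A(3)] by blast
    then have "u i * cnj (u i) = 1"
      by (simp add: complex_norm_square [symmetric])
    then show ?thesis
      using A(4) by (metis inverse_unique)
  qed
  then have "map_matrix cnj (transpose A) = monomial (inv_into UNIV \<sigma>) (\<lambda>i. inverse (u (inv_into UNIV \<sigma> i)))"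
  proof -
    have "i = \<sigma> j \<longleftrightarrow> j = inv_into UNIV \<sigma> i" for i j
      using A(2) by (metis bij_inv_eq_iff)
    then show ?thesis
      by (simp add: A(1) vec_eq_iff map_matrix_def transpose_def \<open>\<And>i. cnj (u i) = inverse (u i)\<close>)
  qed
  then show "A \<in> unitary_matrices"
    using monomial_right_inverse [of \<sigma> u] A by (simp add: unitary_matrices_def)
qed

section \<open>Generation of \<open>G(m,p,d)\<close> by its reflections\<close>

lemma transp_refl_1: "transp_refl a b 1 = monomial (Transposition.transpose a b) (\<lambda>k. 1)"
  by (simp add: transp_refl_def vec_eq_iff)

text \<open>For \<open>a \<noteq> b\<close> and \<open>c \<noteq> 0\<close> these are diagonal
  matrices of determinant 1, obtained from transposition reflections alone. They serve to shift a
  factor from one diagonal entry to another.\<close>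

lemma transp_refl_mult_transp_refl_1:
  "transp_refl a b c ** transp_refl a b 1 =
    monomial id (\<lambda>k. if k = a then c else if k = b then inverse c else 1)"
  unfolding transp_refl_1 by (simp add: transp_refl_def monomial_mult cong: if_cong)

lemma permutation_matrix_mem:
  fixes K :: "(complex ^ 'd ^ 'd) set"
  assumes "subgroup K GL" and "\<And>a b. a \<noteq> b \<Longrightarrow> transp_refl a b 1 \<in> K" and "bij \<sigma>"
  shows "monomial \<sigma> (\<lambda>k. 1) \<in> K"
proof -
  have "\<sigma> permutes UNIV"
    using assms(3) by (intro bij_imp_permutes) auto
  from this finite show ?thesis
  proof (induction rule: permutes_induct)
    case id
    then show ?case
      using subgroup.one_closed [OF assms(1)] by (simp add: mat_eq_monomial id_def)
  next
    case (swap a b p)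
    \<comment> \<open>Composition is reversed in \<open>monomial_mult\<close>, so a transposition
      applied after \<open>p\<close> is a factor on the right.\<close>
    have "monomial p (\<lambda>k. 1) ** transp_refl a b 1 \<in> K"
      using swap assms subgroup.m_closed [OF assms(1)] by simp
    then show ?case
      by (simp add: transp_refl_1 monomial_mult o_def)
  qed
qed

text \<open>All entries outside one coordinate \<open>i0\<close> are produced by diagonal matrices
  of determinant 1, at the cost of their inverses at \<open>i0\<close>. A single diagonal reflection
  at \<open>i0\<close>, with parameter the product of all \<open>u i\<close>, then corrects the
  entry there.\<close>

lemma diagonal_matrix_mem:
  fixes K :: "(complex ^ 'd ^ 'd) set"
  assumes K: "subgroup K GL"
    and transp: "\<And>a b c. a \<noteq> b \<Longrightarrow> c ^ m = 1 \<Longrightarrow> transp_refl a b c \<in> K"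
    and diag: "\<And>a t. t \<noteq> 1 \<Longrightarrow> t ^ n = 1 \<Longrightarrow> diag_refl a t \<in> K"
    and "m > 0" and u: "\<And>i. u i ^ m = 1" and prod: "(\<Prod>i\<in>UNIV. u i) ^ n = 1"
  shows "monomial id u \<in> K"
proof -
  note m_closed = subgroup.m_closed [OF K, simplified]
  have nz: "u i \<noteq> 0" for i
    using u root_of_unity_nonzero \<open>m > 0\<close> by blast
  \<comment> \<open>An arbitrary coordinate, in which the compensating factors are
    collected.\<close>
  obtain i0 :: 'd where True
    by simp
  \<comment> \<open>The entries in \<open>A\<close> are already correct and \<open>i0\<close>
    balances them, so the total product stays 1 and no diagonal reflection is used so far.\<close>
  have partial: "monomial id (\<lambda>k. if k \<in> A then u k else if k = i0 then \<Prod>i\<in>A. inverse (u i) else 1) \<in> K"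
    if "finite A" "i0 \<notin> A" for A
    using that
  proof (induction rule: finite_induct)
    case empty
    have "(\<lambda>k. if k \<in> {} then u k else if k = i0 then \<Prod>i\<in>{}. inverse (u i) else 1) = (\<lambda>k. 1)"
      by auto
    then show ?case
      using subgroup.one_closed [OF K] by (simp only: GL_one mat_eq_monomial)
  next
    case (insert a A)
    let ?v = "\<lambda>k. if k \<in> A then u k else if k = i0 then \<Prod>i\<in>A. inverse (u i) else 1"
    let ?w = "\<lambda>k. if k = a then u a else if k = i0 then inverse (u a) else 1"
    have "monomial id ?v \<in> K"
      using insert.IH insert.prems by blast
    moreover have "monomial id ?w \<in> K"
      unfolding transp_refl_mult_transp_refl_1 [symmetric] using insert u
      by (intro m_closed transp) auto
    ultimately have "monomial id ?w ** monomial id ?v \<in> K"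
      by (rule m_closed [rotated])
    moreover have "(\<lambda>k. ?w k * ?v k) =
        (\<lambda>k. if k \<in> insert a A then u k else if k = i0 then \<Prod>i\<in>insert a A. inverse (u i) else 1)"
      using insert by auto
    ultimately show ?case
      by (simp only: monomial_mult id_def o_def)
  qed
  define t where "t = (\<Prod>i\<in>UNIV. u i)"
  let ?A = "UNIV - {i0}"
  let ?v = "\<lambda>k. if k \<in> ?A then u k else if k = i0 then \<Prod>i\<in>?A. inverse (u i) else 1"
  have "diag_refl i0 t \<in> K"
  proof (cases "t = 1")
    case True
    then show ?thesis
      using subgroup.one_closed [OF K] by (simp add: mat_eq_monomial diag_refl_def)
  next
    case False
    then show ?thesis
      using prod by (intro diag) (auto simp: t_def)
  qed
  moreover have "monomial id ?v \<in> K"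
    by (rule partial) auto
  ultimately have "diag_refl i0 t ** monomial id ?v \<in> K"
    by (rule m_closed)
  moreover have "(if k = i0 then t else 1) * ?v k = u k" for k
  proof (cases "k = i0")
    case True
    have "t = u i0 * (\<Prod>i\<in>?A. u i)"
      unfolding t_def by (simp add: prod.remove)
    moreover have "(\<Prod>i\<in>?A. inverse (u i)) = inverse (\<Prod>i\<in>?A. u i)"
      by (simp add: o_def flip: prod_inversef)
    moreover have "(\<Prod>i\<in>?A. u i) \<noteq> 0"
      using nz by simp
    ultimately show ?thesis
      using True by simp
  qed simp
  ultimately show ?thesis
    by (simp only: diag_refl_def monomial_mult id_def o_def)
qed

text \<open>A monomial matrix is a diagonal matrix times a permutation matrix. The subgroup
  \<open>K\<close> is left general because the lemma serves both to generate \<open>G(m,p,d)\<close>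
  and to bound maximal reflection groups from below.\<close>

lemma Gmp_subset_subgroup:
  fixes K :: "(complex ^ 'd ^ 'd) set"
  assumes K: "subgroup K GL"
    and transp: "\<And>a b c. a \<noteq> b \<Longrightarrow> c ^ m = 1 \<Longrightarrow> transp_refl a b c \<in> K"
    and diag: "\<And>a t. t \<noteq> 1 \<Longrightarrow> t ^ (m div p) = 1 \<Longrightarrow> diag_refl a t \<in> K"
    and "m > 0"
  shows "Gmp m p \<subseteq> K"
proof
  fix A :: "complex ^ 'd ^ 'd"
  assume "A \<in> Gmp m p"
  then obtain \<sigma> u where A: "A = monomial \<sigma> u" "bij \<sigma>" "\<And>i. u i ^ m = 1"
    "(\<Prod>i\<in>UNIV. u i) ^ (m div p) = 1"
    by (rule Gmp_cases [OF _ \<open>m > 0\<close>]) blast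
  have "monomial id u \<in> K"
    by (rule diagonal_matrix_mem [OF K transp diag]) (use A \<open>m > 0\<close> in auto)
  moreover have "monomial \<sigma> (\<lambda>k. 1) \<in> K"
    by (rule permutation_matrix_mem [OF K transp]) (use A in auto)
  ultimately have "monomial id u ** monomial \<sigma> (\<lambda>k. 1) \<in> K"
    using subgroup.m_closed [OF K] by simp
  then show "A \<in> K"
    by (simp add: monomial_mult A(1))
qed

lemma complex_reflection_group_Gmp:
  assumes "m > 0" and "p dvd m"
  shows "complex_reflection_group (Gmp m p :: (complex ^ 'd ^ 'd) set)"
proof -
  let ?G = "Gmp m p :: (complex ^ 'd ^ 'd) set"
  let ?S = "{g \<in> ?G. reflection g}"
  have G: "subgroup ?G GL"
    using assms(1) by (rule subgroup_Gmp)
  have gen: "subgroup (generate GL ?S) GL"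
    using subgroup.subset [OF G] by (intro GL.generate_is_subgroup) auto
  have "?G \<subseteq> generate GL ?S"
  proof (rule Gmp_subset_subgroup [OF gen])
    show "transp_refl a b c \<in> generate GL ?S" if "a \<noteq> b" "c ^ m = 1" for a b c
      using that assms root_of_unity_nonzero [OF that(2)]
      by (intro generate.incl) (auto simp: transp_refl_in_Gmp_iff reflection_transp_refl)
    show "diag_refl a t \<in> generate GL ?S" if "t \<noteq> 1" "t ^ (m div p) = 1" for a t
      using that assms power_div_eq_1 [of t m p 1] root_of_unity_nonzero [of t m]
      by (intro generate.incl) (auto simp: diag_refl_in_Gmp_iff reflection_diag_refl)
  qed (use assms in auto)
  moreover have "generate GL ?S \<subseteq> ?G"
    using G by (intro GL.generate_subgroup_incl) auto
  ultimately have "?G = generate GL ?S"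
    by (rule subset_antisym)
  then have "\<exists>S. (\<forall>g\<in>S. reflection g) \<and> ?G = generate GL S"
    by (intro exI [of _ ?S]) simp
  then show ?thesis
    unfolding complex_reflection_group_def using finite_Gmp [OF assms(1)] G by simp
qed

text \<open>The transposition reflections in the group determine \<open>m\<close>, and the diagonal
  ones determine \<open>m div p\<close>. A transposition exists because the dimension is at least
  2.\<close>

lemma Gmp_eq_iff:
  fixes m p m' p' :: nat
  assumes "m > 0" "p dvd m" "m' > 0" "p' dvd m'" "CARD('d::finite) \<ge> 2"
  shows "Gmp m p = (Gmp m' p' :: (complex ^ 'd ^ 'd) set) \<longleftrightarrow> m = m' \<and> p = p'"
proof
  assume eq: "Gmp m p = (Gmp m' p' :: (complex ^ 'd ^ 'd) set)"
  obtain a b :: 'd where "a \<noteq> b"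
    using assms(5) by (metis card_2_iff' ex_card)
  then have "c ^ m = 1 \<longleftrightarrow> c ^ m' = 1" for c :: complex
    using eq transp_refl_in_Gmp_iff [of m a b c p] transp_refl_in_Gmp_iff [of m' a b c p'] assms by simp
  then have m: "m = m'"
    using root_of_unity_dvd [of m m'] root_of_unity_dvd [of m' m] assms by (simp add: dvd_antisym)
  have *: "m div p > 0" "m div p' > 0"
    using assms m by (auto simp: dvd_div_eq_0_iff)
  have "t ^ (m div p) = 1 \<longleftrightarrow> t ^ (m div p') = 1" for t :: complex
    using eq diag_refl_in_Gmp_iff [of m p a t] diag_refl_in_Gmp_iff [of m p' a t] assms m by simp
  then have "m div p = m div p'"
    using root_of_unity_dvd [of "m div p" "m div p'"] root_of_unity_dvd [of "m div p'" "m div p"] *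
    by (simp add: dvd_antisym)
  moreover have "m = p * (m div p)" "m = p' * (m div p')"
    using assms m by auto
  ultimately have "p = p'"
    using *(1) by (metis mult_right_cancel not_gr_zero)
  with m show "m = m' \<and> p = p'"
    by simp
qed simp

section \<open>The maximal reflection group\<close>

lemma mat_commute: "mat c ** A = A ** mat (c :: 'a::comm_semiring_1)"
proof -
  have "(\<Sum>k\<in>UNIV. mat c $ i $ k * A $ k $ j) = (\<Sum>k\<in>UNIV. if k = i then c * A $ k $ j else 0)" for i j
    by (intro sum.cong) (auto simp: mat_def)
  moreover have "(\<Sum>k\<in>UNIV. A $ i $ k * mat c $ k $ j) = (\<Sum>k\<in>UNIV. if k = j then A $ i $ k * c else 0)" for i j
    by (intro sum.cong) (auto simp: mat_def)
  ultimately show ?thesis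
    by (simp add: vec_eq_iff matrix_matrix_mult_def mult.commute)
qed

text \<open>The central factor cancels. Both directions of conjugation are needed since inverses of
  generators also occur in \<open>generate\<close>; \<open>z\<close> will be a scalar
  matrix.\<close>

lemma (in group) conj_central_mult:
  assumes "z \<in> carrier G" "\<And>x. x \<in> carrier G \<Longrightarrow> z \<otimes> x = x \<otimes> z" "g \<in> carrier G" "n \<in> carrier G"
  shows "(z \<otimes> g) \<otimes> n \<otimes> inv (z \<otimes> g) = g \<otimes> n \<otimes> inv g"
    and "inv (z \<otimes> g) \<otimes> n \<otimes> (z \<otimes> g) = inv g \<otimes> n \<otimes> g"
proof -
  have "(z \<otimes> g) \<otimes> n \<otimes> inv (z \<otimes> g) = (z \<otimes> (g \<otimes> n \<otimes> inv g)) \<otimes> inv z"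
    using assms(1,3,4) by (simp add: inv_mult_group m_assoc)
  also have "z \<otimes> (g \<otimes> n \<otimes> inv g) = (g \<otimes> n \<otimes> inv g) \<otimes> z"
    using assms by simp
  also have "\<dots> \<otimes> inv z = g \<otimes> n \<otimes> inv g"
    using assms(1,3,4) by (simp add: m_assoc)
  finally show "(z \<otimes> g) \<otimes> n \<otimes> inv (z \<otimes> g) = g \<otimes> n \<otimes> inv g" .
  have "inv (z \<otimes> g) \<otimes> n \<otimes> (z \<otimes> g) = inv g \<otimes> (inv z \<otimes> (n \<otimes> (z \<otimes> g)))"
    using assms(1,3,4) by (simp add: inv_mult_group m_assoc)
  also have "n \<otimes> (z \<otimes> g) = z \<otimes> (n \<otimes> g)"
    using assms(1,3,4) assms(2) [of n] by (simp flip: m_assoc)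
  also have "inv z \<otimes> (z \<otimes> (n \<otimes> g)) = n \<otimes> g"
    using assms(1,3,4) by (simp flip: m_assoc)
  finally show "inv (z \<otimes> g) \<otimes> n \<otimes> (z \<otimes> g) = inv g \<otimes> n \<otimes> g"
    using assms(1,3,4) by (simp add: m_assoc)
qed

section \<open>Normality in the maximal reflection group\<close>

lemma reflection_invertible: "reflection r \<Longrightarrow> invertible r"
  by (simp add: reflection_def)

lemma max_reflection_group_of_subgroup: "subgroup (max_reflection_group_of G) GL"
  unfolding max_reflection_group_of_def
  by (rule GL.generate_is_subgroup) (auto simp: reflection_invertible)

lemma conj_max_reflection_group_of:
  fixes G :: "(complex ^ 'd ^ 'd) set"
  assumes G: "subgroup G GL" and "h \<in> max_reflection_group_of G" and "n \<in> G"
  shows "h \<otimes>\<^bsub>GL\<^esub> n \<otimes>\<^bsub>GL\<^esub> inv\<^bsub>GL\<^esub> h \<in> G"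
proof -
  interpret G: subgroup G GL
    by (rule G)
  have scal: "mat c \<in> carrier GL" if "c \<noteq> 0" for c :: complex
    unfolding mat_eq_monomial using that by (auto intro!: invertible_monomial)
  \<comment> \<open>The induction statement quantifies over \<open>n\<close>: for a product
    \<open>h1 h2\<close>, the hypothesis for \<open>h1\<close> is applied to the conjugate of
    \<open>n\<close> by \<open>h2\<close>.\<close>
  have "h \<in> carrier GL \<and> (\<forall>n\<in>G. h \<otimes>\<^bsub>GL\<^esub> n \<otimes>\<^bsub>GL\<^esub> inv\<^bsub>GL\<^esub> h \<in> G)"
    using assms(2) unfolding max_reflection_group_of_def
  proof (induction rule: generate.induct)
    case one
    then show ?case
      using G.mem_carrier by (simp del: GL_mult GL_one GL_carrier)
  next
    case (incl r)
    then obtain c g where r: "c \<noteq> 0" "g \<in> G" "r = mat c \<otimes>\<^bsub>GL\<^esub> g"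
      by auto
    have "r \<otimes>\<^bsub>GL\<^esub> n \<otimes>\<^bsub>GL\<^esub> inv\<^bsub>GL\<^esub> r \<in> G" if "n \<in> G" for n
    proof -
      have "r \<otimes>\<^bsub>GL\<^esub> n \<otimes>\<^bsub>GL\<^esub> inv\<^bsub>GL\<^esub> r = g \<otimes>\<^bsub>GL\<^esub> n \<otimes>\<^bsub>GL\<^esub> inv\<^bsub>GL\<^esub> g"
        unfolding r(3) using r that scal G.mem_carrier
        by (intro GL.conj_central_mult) (auto simp: mat_commute)
      then show ?thesis
        using r(2) that by (metis G.m_closed G.m_inv_closed)
    qed
    moreover have "r \<in> carrier GL"
      unfolding r(3) using r scal G.mem_carrier by blast
    ultimately show ?case
      by blast
  next
    case (inv r)
    then obtain c g where r: "c \<noteq> 0" "g \<in> G" "r = mat c \<otimes>\<^bsub>GL\<^esub> g"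
      by auto
    have rc: "r \<in> carrier GL"
      unfolding r(3) using r scal G.mem_carrier by blast
    have "inv\<^bsub>GL\<^esub> r \<otimes>\<^bsub>GL\<^esub> n \<otimes>\<^bsub>GL\<^esub> r \<in> G" if "n \<in> G" for n
    proof -
      have "inv\<^bsub>GL\<^esub> r \<otimes>\<^bsub>GL\<^esub> n \<otimes>\<^bsub>GL\<^esub> r = inv\<^bsub>GL\<^esub> g \<otimes>\<^bsub>GL\<^esub> n \<otimes>\<^bsub>GL\<^esub> g"
        unfolding r(3) using r that scal G.mem_carrier
        by (intro GL.conj_central_mult) (auto simp: mat_commute)
      then show ?thesis
        using r(2) that by (metis G.m_closed G.m_inv_closed)
    qed
    then show ?case
      using rc GL.inv_closed GL.inv_inv by metis
  next
    case (eng h1 h2)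
    have "(h1 \<otimes>\<^bsub>GL\<^esub> h2) \<otimes>\<^bsub>GL\<^esub> n \<otimes>\<^bsub>GL\<^esub> inv\<^bsub>GL\<^esub> (h1 \<otimes>\<^bsub>GL\<^esub> h2) =
        h1 \<otimes>\<^bsub>GL\<^esub> (h2 \<otimes>\<^bsub>GL\<^esub> n \<otimes>\<^bsub>GL\<^esub> inv\<^bsub>GL\<^esub> h2) \<otimes>\<^bsub>GL\<^esub> inv\<^bsub>GL\<^esub> h1" if "n \<in> G" for n
      using eng that G.mem_carrier by (simp add: GL.inv_mult_group GL.m_assoc del: GL_mult GL_carrier)
    then show ?case
      using eng GL.m_closed by (metis (no_types, lifting))
  qed
  then show ?thesis
    using assms(3) by blast
qed

lemma subset_max_reflection_group_of:
  assumes "complex_reflection_group G"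
  shows "G \<subseteq> max_reflection_group_of G"
proof -
  obtain S where S: "\<And>g. g \<in> S \<Longrightarrow> reflection g" "G = generate GL S"
    using assms unfolding complex_reflection_group_def by blast
  have "\<exists>c g'. c \<noteq> 0 \<and> g' \<in> G \<and> g = mat c ** g'" if "g \<in> S" for g
    using that S(2) by (intro exI [of _ 1] exI [of _ g]) (auto intro: generate.incl)
  then have "generate GL S \<subseteq> max_reflection_group_of G"
    unfolding max_reflection_group_of_def using S(1)
    by (intro GL.mono_generate) blast
  then show ?thesis
    using S(2) by simp
qed

lemma proper_normal_subgroup_max_reflection_group_of:
  assumes "complex_reflection_group G" and "max_reflection_group_of G \<noteq> G"
  shows "proper_normal_subgroup G (max_reflection_group_of G)"
proof -
  let ?H = "max_reflection_group_of G"
  have H: "subgroup ?H GL"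
    by (rule max_reflection_group_of_subgroup)
  have G: "subgroup G GL"
    using assms(1) by (simp add: complex_reflection_group_def)
  interpret H: group "GL\<lparr>carrier := ?H\<rparr>"
    using H by (rule GL.subgroup_imp_group)
  have "G \<lhd> GL\<lparr>carrier := ?H\<rparr>"
  proof (rule H.normal_invI)
    show "subgroup G (GL\<lparr>carrier := ?H\<rparr>)"
      using G H subset_max_reflection_group_of [OF assms(1)] by (rule GL.subgroup_incl)
    fix x h
    assume x: "x \<in> carrier (GL\<lparr>carrier := ?H\<rparr>)" and h: "h \<in> G"
    then have "inv\<^bsub>GL\<lparr>carrier := ?H\<rparr>\<^esub> x = inv\<^bsub>GL\<^esub> x"
      using GL.m_inv_consistent [OF H] by simp
    then show "x \<otimes>\<^bsub>GL\<lparr>carrier := ?H\<rparr>\<^esub> h \<otimes>\<^bsub>GL\<lparr>carrier := ?H\<rparr>\<^esub> inv\<^bsub>GL\<lparr>carrier := ?H\<rparr>\<^esub> x \<in> G"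
      using conj_max_reflection_group_of [OF G _ h, of x] x by simp
  qed
  then show ?thesis
    using H assms(2) by (auto simp: proper_normal_subgroup_def)
qed

section \<open>Reflections among scalar multiples of elements of \<open>G(m,p,d)\<close>\<close>

text \<open>In the diagonal case a second coordinate \<open>k\<close> has
  \<open>c * u k = 1\<close>, so \<open>inverse c\<close> is an \<open>m\<close>-th root of unity
  and the product of the \<open>u i\<close> is \<open>inverse c ^ d * t\<close>. In the
  transposition case with \<open>d \<ge> 3\<close> a fixed coordinate gives \<open>c ^ m = 1\<close>
  likewise; with \<open>d = 2\<close> only the quotient \<open>u a / u b = s^2\<close> and the
  product \<open>u a * u b\<close> constrain \<open>s\<close>.\<close>

lemma scaled_reflection_cases:
  fixes g :: "complex ^ 'd ^ 'd"
  assumes "m > 0" "p dvd m" "g \<in> Gmp m p" "c \<noteq> 0" "reflection (mat c ** g)" "CARD('d) \<ge> 2"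
  obtains (diag) a t where "mat c ** g = diag_refl a t" "t ^ (m div gcd p CARD('d)) = 1"
  | (transp) a b s where "a \<noteq> b" "mat c ** g = transp_refl a b s"
      "s ^ (if CARD('d) = 2 then 2 * m div gcd p 2 else m) = 1"
proof -
  let ?d = "CARD('d)"
  obtain \<sigma> u where g: "g = monomial \<sigma> u" and \<sigma>: "bij \<sigma>" and u: "\<And>i. u i ^ m = 1"
    and prod: "(\<Prod>i\<in>UNIV. u i) ^ (m div p) = 1" and nz: "\<And>i. u i \<noteq> 0"
    by (rule Gmp_cases [OF assms(3,1)]) blast
  define w where "w = (\<lambda>i. c * u i)"
  have r: "mat c ** g = monomial \<sigma> w"
    by (simp add: g mat_mult_monomial w_def)
  have wnz: "w i \<noteq> 0" for i
    using nz \<open>c \<noteq> 0\<close> by (simp add: w_def)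
  from assms(5) have "reflection (monomial \<sigma> w)"
    by (simp only: r)
  then show thesis
    using \<sigma> wnz
  proof (cases rule: reflection_monomial_cases)
    case (diag a)
    let ?t = "w a" and ?n = "m div gcd p ?d"
    have "w = (\<lambda>k. if k = a then ?t else 1)"
      using diag by auto
    then have "mat c ** g = diag_refl a ?t"
      unfolding r diag_refl_def using diag(1) by simp
    moreover have "?t ^ ?n = 1"
    proof -
      obtain k where "k \<noteq> a"
        using assms(6) by (metis card_2_iff' ex_card)
      then have "c * u k = 1"
        using diag(3) [of k] by (simp add: w_def)
      then have "u k = inverse c"
        using \<open>c \<noteq> 0\<close> by (metis inverse_unique)
      then have c: "inverse c ^ m = 1"
        using u [of k] by simp
      have "u i = inverse c * (if i = a then ?t else 1)" for i
        using diag(3) [of i] \<open>c \<noteq> 0\<close> by (simp add: w_def field_simps)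
      then have "(\<Prod>i\<in>UNIV. u i) = (\<Prod>i\<in>UNIV. inverse c * (if i = a then ?t else 1))"
        by (intro prod.cong) auto
      also have "\<dots> = inverse c ^ ?d * ?t"
        by (simp only: prod.distrib prod_constant prod.delta finite UNIV_I if_True)
      finally have prod_eq: "(\<Prod>i\<in>UNIV. u i) = inverse c ^ ?d * ?t" .
      \<comment> \<open>The exponent is a multiple of \<open>m\<close>, so the factor
        \<open>inverse c ^ ?d\<close> disappears and only \<open>?t\<close> remains.\<close>
      have "?d * ?n = m * (?d div gcd p ?d)"
      proof -
        have "gcd p ?d dvd m"
          using assms(2) by (meson dvd_trans gcd_dvd1)
        then have "?d * ?n = ?d * m div gcd p ?d"
          by (simp add: div_mult_swap)
        also have "\<dots> = m * ?d div gcd p ?d"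
          by (simp add: mult.commute)
        also have "\<dots> = m * (?d div gcd p ?d)"
          by (simp add: div_mult_swap)
        finally show ?thesis .
      qed
      then have "(inverse c ^ ?d) ^ ?n = 1"
        using c by (metis power_mult power_one)
      moreover have "(inverse c ^ ?d * ?t) ^ ?n = 1"
        using power_div_eq_1 [OF prod _ assms(2), of "gcd p ?d"] by (simp only: prod_eq gcd_dvd1)
      ultimately show ?thesis
        by (simp add: power_mult_distrib)
    qed
    ultimately show thesis
      by (rule that(1))
  next
    case (transp a b)
    let ?s = "w a"
    have "w b = inverse ?s"
      using transp(3) by (metis inverse_unique)
    then have "w = (\<lambda>k. if k = a then ?s else if k = b then inverse ?s else 1)"
      using transp(4) by auto
    then have "mat c ** g = transp_refl a b ?s"
      unfolding r transp_refl_def using transp(2) by simp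
    moreover have "?s ^ (if ?d = 2 then 2 * m div gcd p 2 else m) = 1"
    proof (cases "?d = 2")
      case True
      have UNIV: "UNIV = {a, b}"
        using True transp(1) card_subset_eq [of UNIV "{a, b}"] by simp
      have "(\<Prod>i\<in>UNIV. u i) = u a * u b"
        unfolding UNIV using transp(1) by simp
      then have ab: "(u a * u b) ^ (m div gcd p 2) = 1"
        using power_div_eq_1 [OF prod _ assms(2), of "gcd p 2"] by simp
      have s: "?s\<^sup>2 * u b = u a"
        using transp(3) by (simp add: w_def power2_eq_square algebra_simps)
      show ?thesis
      proof (cases "even p")
        case False
        then have "gcd p 2 = 1"
          by (simp add: coprime_right_2_iff_odd flip: coprime_iff_gcd_eq_1)
        moreover have "(?s\<^sup>2) ^ m * u b ^ m = u a ^ m"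
          by (simp flip: s power_mult_distrib)
        ultimately show ?thesis
          using True u by (simp add: power_mult)
      next
        case even: True
        then have gcd: "gcd p 2 = 2"
          by (simp add: gcd_proj2_if_dvd)
        \<comment> \<open>For even \<open>p\<close> the quotient alone would give only
          \<open>s ^ (2 * m) = 1\<close>. The sharper \<open>s ^ m = 1\<close> comes from the
          product \<open>u a * u b\<close>, whose \<open>n\<close>-th power is 1.\<close>
        obtain n where n: "m = 2 * n"
          using even assms(2) by (meson dvd_trans evenE)
        have "?s\<^sup>2 * (u b)\<^sup>2 = u a * u b"
          by (simp add: power2_eq_square flip: s)
        then have "(?s\<^sup>2 * (u b)\<^sup>2) ^ n = 1"
          using ab gcd n by simp
        then have "?s ^ m * u b ^ m = 1"
          by (simp add: n power_mult_distrib power_mult)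
        then show ?thesis
          using True gcd u by simp
      qed
    next
      case False
      then have "card {a, b} < ?d"
        using assms(6) transp(1) by simp
      then obtain k where "k \<notin> {a, b}"
        by (metis UNIV_eq_I less_irrefl)
      then have "c * u k = 1"
        using transp(4) [of k] by (simp add: w_def)
      then have "c ^ m * u k ^ m = 1"
        by (simp flip: power_mult_distrib)
      then show ?thesis
        using False u by (simp add: w_def power_mult_distrib)
    qed
    ultimately show thesis
      by (rule that(2) [OF transp(1)])
  qed
qed

text \<open>A diagonal matrix with entries \<open>z ^ x\<close>, except for \<open>z ^ x * t\<close>
  at \<open>a\<close>, is a scalar multiple of the reflection. It lies in the group once its product
  is the \<open>p\<close>-th power of an \<open>m\<close>-th root of unity, which a suitable
  \<open>x\<close> achieves.\<close>

lemma diag_refl_scalar_multiple: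
  fixes a :: "'d::finite"
  assumes "m > 0" "p > 0" "p dvd m" "t ^ (m div gcd p CARD('d)) = 1"
  shows "\<exists>c g. c \<noteq> 0 \<and> g \<in> Gmp m p \<and> diag_refl a t = mat c ** g"
proof -
  let ?d = "CARD('d)"
  let ?g = "gcd p ?d"
  have "?g > 0"
    using assms(2) by simp
  have "?g dvd m"
    using assms(3) by (meson dvd_trans gcd_dvd1)
  \<comment> \<open>Any such root satisfies \<open>z ^ m = t ^ (m div ?g) = 1\<close>.\<close>
  obtain z where z: "z ^ ?g = t"
    using exists_complex_root [of ?g t] \<open>?g > 0\<close> by auto
  have zm: "z ^ m = 1"
    using assms(4) \<open>?g dvd m\<close> by (simp flip: z power_mult)
  \<comment> \<open>By Bezout in the natural numbers, the product \<open>z ^ (?d * x + ?g)\<close>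
    of the entries is the \<open>p\<close>-th power of \<open>z ^ y\<close>.\<close>
  obtain x y where xy: "p * y = ?d * x + ?g"
    using bezout_nat [of p ?d] assms(2) by auto
  let ?u = "\<lambda>k. z ^ x * (if k = a then t else 1)"
  have "(\<Prod>k\<in>UNIV. ?u k) = (z ^ x) ^ ?d * t"
    by (simp only: prod.distrib prod_constant prod.delta finite UNIV_I if_True)
  also have "\<dots> = z ^ (p * y)"
    unfolding xy by (simp add: power_add z mult.commute flip: power_mult)
  finally have "(\<Prod>k\<in>UNIV. ?u k) ^ (m div p) = z ^ (p * y * (m div p))"
    by (simp add: power_mult)
  also have "p * y * (m div p) = m * y"
    using assms(3) by auto
  finally have "(\<Prod>k\<in>UNIV. ?u k) ^ (m div p) = 1"
    by (simp add: power_mult zm)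
  moreover have "(z ^ x) ^ m = 1"
    by (metis zm power_mult mult.commute power_one)
  moreover have "t ^ m = 1"
    by (metis zm z power_mult mult.commute power_one)
  ultimately have "monomial id ?u \<in> Gmp m p"
    using assms(1) by (intro monomial_in_Gmp) (auto simp: power_mult_distrib)
  moreover have "z \<noteq> 0"
    using root_of_unity_nonzero [OF zm assms(1)] .
  then have "diag_refl a t = mat (inverse (z ^ x)) ** monomial id ?u"
    unfolding diag_refl_def mat_mult_monomial by (simp add: vec_eq_iff)
  ultimately show ?thesis
    using \<open>z \<noteq> 0\<close> by (intro exI [of _ "inverse (z ^ x)"] exI [of _ "monomial id ?u"]) simp
qed

text \<open>Unless \<open>d = 2\<close> and \<open>p\<close> is odd, the exponent is
  \<open>m\<close>, and the reflection lies in the group already with scalar 1. In the exceptional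
  case \<open>s\<close> is a \<open>2 * m\<close>-th root of unity and a genuine rescaling is
  required.\<close>

lemma transp_refl_scalar_multiple:
  fixes a b :: "'d::finite"
  assumes "m > 0" "p dvd m" "a \<noteq> b"
    and s: "s ^ (if CARD('d) = 2 then 2 * m div gcd p 2 else m) = 1"
  shows "\<exists>c g. c \<noteq> 0 \<and> g \<in> Gmp m p \<and> transp_refl a b s = mat c ** g"
proof (cases "CARD('d) = 2 \<and> odd p")
  case False
  have "s ^ m = 1"
  proof (cases "CARD('d) = 2")
    case True
    with False have "gcd p 2 = 2"
      by (simp add: gcd_proj2_if_dvd)
    then show ?thesis
      using s True by simp
  qed (use s in simp)
  then have "transp_refl a b s \<in> Gmp m p"
    using assms by (simp add: transp_refl_in_Gmp_iff)
  then show ?thesis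
    by (intro exI [of _ 1] exI [of _ "transp_refl a b s"]) simp
next
  case True
  then have "gcd p 2 = 1"
    by (simp add: coprime_right_2_iff_odd flip: coprime_iff_gcd_eq_1)
  with s True have s2m: "s ^ (2 * m) = 1"
    by simp
  have "s \<noteq> 0"
    using root_of_unity_nonzero [OF s2m] assms(1) by simp
  obtain k where k: "p = 2 * k + 1"
    using True oddE by blast
  define y where "y = s ^ (2 * k)"
  have "y ^ m = (s ^ (2 * m)) ^ k"
    unfolding y_def by (simp add: mult_ac flip: power_mult)
  then have ym: "y ^ m = 1"
    by (simp add: s2m)
  \<comment> \<open>Two entries with quotient \<open>s\<^sup>2\<close>, scaled so that their product is the \<open>p\<close>-th power
    of the \<open>m\<close>-th root of unity \<open>s\<^sup>2\<close>.\<close>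
  let ?u = "\<lambda>i. if i = a then s\<^sup>2 * y else y"
  have UNIV: "UNIV = {a, b}"
    using True assms(3) card_subset_eq [of UNIV "{a, b}"] by simp
  have "(\<Prod>i\<in>UNIV. ?u i) = s\<^sup>2 * y * y"
    unfolding UNIV using assms(3) by simp
  also have "\<dots> = s ^ (2 + 2 * k + 2 * k)"
    unfolding y_def by (simp only: power_add)
  also have "2 + 2 * k + 2 * k = 2 * p"
    using k by simp
  finally have "(\<Prod>i\<in>UNIV. ?u i) ^ (m div p) = s ^ (2 * p * (m div p))"
    by (simp add: power_mult)
  also have "2 * p * (m div p) = 2 * m"
    using assms(2) by simp
  finally have "(\<Prod>i\<in>UNIV. ?u i) ^ (m div p) = 1"
    by (simp add: s2m)
  then have "monomial (Transposition.transpose a b) ?u \<in> Gmp m p"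
    using assms(1) ym s2m by (intro monomial_in_Gmp) (auto simp: power_mult_distrib simp flip: power_mult)
  moreover have "y \<noteq> 0"
    using \<open>s \<noteq> 0\<close> by (simp add: y_def)
  \<comment> \<open>The number \<open>s * y\<close> is a square root of the product of the entries
    \<open>s^2 * y\<close> and \<open>y\<close>; dividing by it leaves \<open>s\<close> and
    \<open>inverse s\<close>. The last branch cannot occur, as \<open>a\<close> and \<open>b\<close>
    are the only indices.\<close>
  have "(if i = a then s else if i = b then inverse s else 1) = inverse (s * y) * ?u i" for i
    using UNIV \<open>s \<noteq> 0\<close> \<open>y \<noteq> 0\<close> assms(3) by (cases "i = a") (auto simp: field_simps power2_eq_square)
  then have "transp_refl a b s = mat (inverse (s * y)) ** monomial (Transposition.transpose a b) ?u"
    unfolding transp_refl_def mat_mult_monomial by (simp add: vec_eq_iff)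
  ultimately show ?thesis
    using \<open>s \<noteq> 0\<close> \<open>y \<noteq> 0\<close>
    by (intro exI [of _ "inverse (s * y)"] exI [of _ "monomial (Transposition.transpose a b) ?u"]) simp
qed

text \<open>In every dimension \<open>m' div p' = m div gcd p d\<close>, which is the order of the
  roots allowed on the diagonal, while \<open>m'\<close> is the order allowed on transpositions. The
  admissible scaled reflections are thus exactly the standard generators of
  \<open>G(m',p',d)\<close>.\<close>

lemma max_reflection_group_of_Gmp:
  fixes m p :: nat
  assumes "m > 0" "p > 0" "p dvd m" "CARD('d) \<ge> 2"
  defines "m' \<equiv> if CARD('d) = 2 then 2 * m div gcd p 2 else m"
    and "p' \<equiv> if CARD('d) = 2 then 2 else gcd p CARD('d)"
  shows "m' > 0" "p' dvd m'"
    "max_reflection_group_of (Gmp m p :: (complex ^ 'd ^ 'd) set) = Gmp m' p'"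
proof -
  have g: "gcd p CARD('d) dvd m"
    using assms(3) by (meson dvd_trans gcd_dvd1)
  then obtain n where n: "m = gcd p CARD('d) * n"
    by blast
  have "gcd p CARD('d) > 0"
    using assms(2) by simp
  have m': "m' = p' * n"
    unfolding m'_def p'_def using n \<open>gcd p CARD('d) > 0\<close>
    by (cases "CARD('d) = 2") (auto simp: mult.left_commute)
  have "n > 0" "p' > 0"
    using n assms(1,2) by (auto simp: p'_def intro!: Nat.gr0I)
  have n_eq: "m div gcd p CARD('d) = n" "m' div p' = n"
    using n m' \<open>gcd p CARD('d) > 0\<close> \<open>p' > 0\<close> by (metis nonzero_mult_div_cancel_left not_gr_zero)+
  show "m' > 0"
    using m' \<open>n > 0\<close> \<open>p' > 0\<close> by simp
  show "p' dvd m'"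
    using m' by simp
  let ?S = "{r. reflection r \<and> (\<exists>c g. c \<noteq> 0 \<and> g \<in> (Gmp m p :: (complex ^ 'd ^ 'd) set) \<and> r = mat c ** g)}"
  have "?S \<subseteq> Gmp m' p'"
  proof
    fix r
    assume "r \<in> ?S"
    then obtain c g where r: "reflection (mat c ** g)" "c \<noteq> 0" "g \<in> Gmp m p" "r = mat c ** g"
      by blast
    show "r \<in> Gmp m' p'"
      using assms(1,3) r(3,2,1) assms(4)
    proof (cases rule: scaled_reflection_cases)
      case (diag a t)
      then show ?thesis
        using diag_refl_in_Gmp_iff [OF \<open>m' > 0\<close> \<open>p' dvd m'\<close>, of a t] r(4) n_eq by simp
    next
      case (transp a b s)
      then show ?thesis
        using transp_refl_in_Gmp_iff [OF \<open>m' > 0\<close> transp(1), of s p'] r(4)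
        unfolding m'_def by simp
    qed
  qed
  then have "generate GL ?S \<subseteq> Gmp m' p'"
    using subgroup_Gmp [OF \<open>m' > 0\<close>] by (rule GL.generate_subgroup_incl)
  moreover have "Gmp m' p' \<subseteq> generate GL ?S"
  proof (rule Gmp_subset_subgroup)
    show "subgroup (generate GL ?S) GL"
      by (rule GL.generate_is_subgroup) (auto simp: reflection_invertible)
    fix a b :: 'd and s :: complex
    assume "a \<noteq> b" and s: "s ^ m' = 1"
    moreover have "\<exists>c g. c \<noteq> 0 \<and> g \<in> Gmp m p \<and> transp_refl a b s = mat c ** g"
      using assms(1,3) \<open>a \<noteq> b\<close> s unfolding m'_def by (rule transp_refl_scalar_multiple)
    ultimately show "transp_refl a b s \<in> generate GL ?S"
      using root_of_unity_nonzero [OF s \<open>m' > 0\<close>] reflection_transp_refl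
      by (intro generate.incl) blast
  next
    fix a :: 'd and t :: complex
    assume "t \<noteq> 1" and t: "t ^ (m' div p') = 1"
    moreover have "\<exists>c g. c \<noteq> 0 \<and> g \<in> Gmp m p \<and> diag_refl a t = mat c ** g"
      using t n_eq by (intro diag_refl_scalar_multiple assms(1-3)) simp
    ultimately show "diag_refl a t \<in> generate GL ?S"
      using root_of_unity_nonzero [OF t] \<open>n > 0\<close> n_eq reflection_diag_refl [of t a]
      by (intro generate.incl) simp
  qed (fact \<open>m' > 0\<close>)
  ultimately show "max_reflection_group_of (Gmp m p :: (complex ^ 'd ^ 'd) set) = Gmp m' p'"
    unfolding max_reflection_group_of_def by (rule subset_antisym)
qed

section \<open>Classification of the maximal groups and the normal inclusions\<close>

theorem theorem8p1:
  fixes m p :: nat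
  assumes "m > 0" and "p > 0" and "p dvd m"
    and "CARD('d::finite) \<ge> 2"
    and "(m, p, CARD('d)) \<noteq> (2, 2, 2)"
  shows
    "let G = (Gmp :: nat \<Rightarrow> nat \<Rightarrow> (complex ^ 'd ^ 'd) set); d = CARD('d) in
       complex_reflection_group (G m p) \<and> G m p \<subseteq> unitary_matrices \<and>
       (maximal_reflection_group (G m p) \<longleftrightarrow>
          d = 2 \<and> (\<exists>a\<ge>2. m = 2 * a \<and> p = 2) \<or>
          d \<ge> 3 \<and> (\<exists>k a. k dvd d \<and> a \<ge> 1 \<and> m = k * a \<and> p = k)) \<and>
       (\<not> maximal_reflection_group (G m p) \<longrightarrow>
          (d = 2 \<longrightarrow>
             (let H = G (2 * m div Gcd {m, p, 2}) 2 in
                maximal_reflection_group H \<and> max_reflection_group_of (G m p) = H \<and>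
                proper_normal_subgroup (G m p) H)) \<and>
          (d \<ge> 3 \<longrightarrow>
             (let H = G m (gcd p d) in
                maximal_reflection_group H \<and> max_reflection_group_of (G m p) = H \<and>
                proper_normal_subgroup (G m p) H)))"
proof -
  let ?d = "CARD('d)"
  define G where "G = (Gmp :: nat \<Rightarrow> nat \<Rightarrow> (complex ^ 'd ^ 'd) set)"
  define m' where "m' = (if ?d = 2 then 2 * m div gcd p 2 else m)"
  define p' where "p' = (if ?d = 2 then 2 else gcd p ?d)"
  have max: "max_reflection_group_of (G m p) = G m' p'" and m': "m' > 0" and p': "p' dvd m'"
    unfolding G_def m'_def p'_def using max_reflection_group_of_Gmp [where 'd='d, OF assms(1-4)] by simp_all
  have "p' > 0"
    using assms(2) by (simp add: p'_def)
  have crg: "complex_reflection_group (G k l)" "G k l \<subseteq> unitary_matrices" if "k > 0" "l dvd k" for k l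
    unfolding G_def using that by (simp_all add: complex_reflection_group_Gmp Gmp_subset_unitary)
  \<comment> \<open>Passing from \<open>(m, p)\<close> to \<open>(m', p')\<close> is idempotent:
    \<open>2 * m' div gcd 2 2 = m'\<close> in dimension 2, and
    \<open>gcd (gcd p d) d = gcd p d\<close> otherwise.\<close>
  have "max_reflection_group_of (G m' p') = G m' p'"
    unfolding G_def using max_reflection_group_of_Gmp(3) [where 'd='d, OF m' \<open>p' > 0\<close> p' assms(4)]
    by (auto simp: m'_def p'_def)
  then have H: "maximal_reflection_group (G m' p')"
    using crg [OF m' p'] by (simp add: maximal_reflection_group_def)
  have iff: "maximal_reflection_group (G m p) \<longleftrightarrow> G m' p' = G m p"
    using crg [OF assms(1,3)] max by (simp add: maximal_reflection_group_def)
  have normal: "proper_normal_subgroup (G m p) (G m' p')" if "\<not> maximal_reflection_group (G m p)"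
    using proper_normal_subgroup_max_reflection_group_of [OF crg(1) [OF assms(1,3)]] that iff
    by (simp add: max)
  have "G m' p' = G m p \<longleftrightarrow> m' = m \<and> p' = p"
    unfolding G_def using m' p' assms by (intro Gmp_eq_iff)
  also have "\<dots> \<longleftrightarrow> ?d = 2 \<and> (\<exists>a\<ge>2. m = 2 * a \<and> p = 2) \<or>
      ?d \<ge> 3 \<and> (\<exists>k a. k dvd ?d \<and> a \<ge> 1 \<and> m = k * a \<and> p = k)"
  proof (cases "?d = 2")
    case True
    have "m' = m \<and> p' = p \<longleftrightarrow> p = 2"
      using True by (auto simp: m'_def p'_def)
    also have "\<dots> \<longleftrightarrow> (\<exists>a\<ge>2. m = 2 * a \<and> p = 2)"
    proof
      assume "p = 2"
      then obtain a where "m = 2 * a"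
        using assms(3) by blast
      \<comment> \<open>The value \<open>a = 1\<close> is precisely the excluded triple
        \<open>(2, 2, 2)\<close>.\<close>
      moreover have "a \<noteq> 0" "a \<noteq> 1"
        using assms(1,5) \<open>p = 2\<close> \<open>m = 2 * a\<close> True by auto
      ultimately show "\<exists>a\<ge>2. m = 2 * a \<and> p = 2"
        using \<open>p = 2\<close> by (intro exI [of _ a]) simp
    qed blast
    finally show ?thesis
      using True by simp
  next
    case False
    then have "?d \<ge> 3"
      using assms(4) by linarith
    have "m' = m \<and> p' = p \<longleftrightarrow> p dvd ?d"
      using False gcd_proj1_iff [of p ?d] by (simp add: m'_def p'_def)
    also have "\<dots> \<longleftrightarrow> (\<exists>k a. k dvd ?d \<and> a \<ge> 1 \<and> m = k * a \<and> p = k)"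
    proof
      assume "p dvd ?d"
      moreover obtain a where "m = p * a"
        using assms(3) by blast
      moreover have "a \<ge> 1"
        using assms(1) \<open>m = p * a\<close> by (cases a) auto
      ultimately show "\<exists>k a. k dvd ?d \<and> a \<ge> 1 \<and> m = k * a \<and> p = k"
        by blast
    qed blast
    finally show ?thesis
      using \<open>?d \<ge> 3\<close> False by simp
  qed
  finally have char: "maximal_reflection_group (G m p) \<longleftrightarrow>
      ?d = 2 \<and> (\<exists>a\<ge>2. m = 2 * a \<and> p = 2) \<or>
      ?d \<ge> 3 \<and> (\<exists>k a. k dvd ?d \<and> a \<ge> 1 \<and> m = k * a \<and> p = k)"
    unfolding iff .
  \<comment> \<open>Including \<open>m\<close> in the greatest common divisor changes nothing,
    because \<open>gcd p 2\<close> divides \<open>p\<close> and hence \<open>m\<close>.\<close>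
  have two: "m' = 2 * m div Gcd {m, p, 2}" "p' = 2" if "?d = 2"
  proof -
    have "gcd p 2 dvd m"
      using assms(3) by (meson dvd_trans gcd_dvd1)
    then have "Gcd {m, p, 2} = gcd p 2"
      by (simp add: gcd_proj2_if_dvd)
    then show "m' = 2 * m div Gcd {m, p, 2}" "p' = 2"
      using that by (simp_all add: m'_def p'_def)
  qed
  have three: "m' = m" "p' = gcd p ?d" if "?d \<ge> 3"
    using that by (simp_all add: m'_def p'_def)
  show ?thesis
    unfolding Let_def G_def [symmetric]
    using crg [OF assms(1,3)] char normal H max two three by metis
qed

end
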